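(* If $f\in\mathcal{C}$, then (i) $|T^{s}_{2,2}(f^{-1})|\le 2$; (ii) $|T^{s}_{2,3}(f^{-1})|\le 2$; (iii) $|T^{s}_{3,2}(f^{-1})|\le 4$. All results are sharp, i.e. each bound is attained by some $f\in\mathcal{C}$.
   Context: Let $\mathbb{D}=\{z\in\mathbb{C}:|z|<1\}$. $\mathcal{A}$ is the class of functions $f$ analytic in $\mathbb{D}$ with $f(0)=0$, $f'(0)=1$, i.e. $f(z)=z+a_2z^2+a_3z^3+\cdots$. $\mathcal{C}=\left\{f\in\mathcal{A}:\mathrm{Re}\left[1+\frac{zf''(z)}{f'(z)}\right]>0,\ z\in\mathbb{D}\right\}$ is the class of convex functions; such functions are univalent (injective) in $\mathbb{D}$. For univalent $f\in\mathcal{A}$ the inverse $f^{-1}$ is defined at least on the disk $|w|<1/4$ (Koebe's 1/4 theorem) and has there an expansion $f^{-1}(w)=w+A_2w^2+A_3w^3+\cdots$. The symmetric Toeplitz determinant $T^{s}_{q,n}(f^{-1})$ is the determinant of the $q\times q$ matrix whose $(i,j)$ entry is $A_{n+|i-j|}$ (no complex conjugation). In particular $$T^{s}_{2,2}(f^{-1})=A_2^2-A_3^2,\quad T^{s}_{2,3}(f^{-1})=A_3^2-A_4^2,\quad T^{s}_{3,2}(f^{-1})=(A_2-A_4)(A_2^2-2A_3^2+A_2A_4).$$ *)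

theory Defs
  imports "HOL-Complex_Analysis.Complex_Analysis" "Jordan_Normal_Form.Determinant"
begin

definition normalized_class :: "(complex \<Rightarrow> complex) set" where
  "normalized_class = {f. f analytic_on ball 0 1 \<and> f 0 = 0 \<and> deriv f 0 = 1}"

text \<open>The condition \<open>deriv f z \<noteq> 0\<close> is implicit on paper, where the quotient must make sense;
  here it is explicit because division by zero is total in HOL.\<close>

definition convex_class :: "(complex \<Rightarrow> complex) set" where
  "convex_class = {f \<in> normalized_class. \<forall>z\<in>ball 0 1.
     deriv f z \<noteq> 0 \<and> Re (1 + z * deriv (deriv f) z / deriv f z) > 0}"

text \<open>The inverse is taken with respect to the unit disc only, so values of \<open>f\<close> outside the disc
  are irrelevant. It is meaningful when \<open>f\<close> is injective on the disc. Its
  Taylor coefficients at \<open>0\<close> depend only on its values near \<open>0\<close>.\<close>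

definition disc_inverse :: "(complex \<Rightarrow> complex) \<Rightarrow> complex \<Rightarrow> complex" where
  "disc_inverse f = the_inv_into (ball 0 1) f"

definition taylor_coeff :: "(complex \<Rightarrow> complex) \<Rightarrow> nat \<Rightarrow> complex" where
  "taylor_coeff g n = fps_nth (fps_expansion g 0) n"

text \<open>Rows and columns are indexed from \<open>0\<close>, which does not affect \<open>\<bar>i - j\<bar>\<close>.\<close>

definition sym_toeplitz_det :: "nat \<Rightarrow> nat \<Rightarrow> (complex \<Rightarrow> complex) \<Rightarrow> complex" where
  "sym_toeplitz_det q n g =
     Determinant.det (Matrix.mat q q (\<lambda>(i, j). taylor_coeff g (n + nat \<bar>int i - int j\<bar>)))"

end

theory Submission
  imports Defs
begin

text \<open>
  For convex \<open>f\<close> the function \<open>P z = 1 + z * f'' z / f' z\<close> has positive real part and value 1 at the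
  origin, so by the Schwarz lemma \<open>(P - 1) / (P + 1) = z * \<psi> z\<close> with \<open>\<psi>\<close> holomorphic and bounded by 1. Write
  \<open>\<psi> z = b1 + b2 * z + b3 * z\<^sup>2 + \<dots>\<close>. The coefficients of the inverse are
    \<open>A2 = - b1\<close>, \<open>A3 = b1\<^sup>2 - b2 / 3\<close> and \<open>A4 = - b1\<^sup>3 + 5/6 * b1 * b2 - b3 / 6\<close>
  (\<open>inverse_taylor_coeffs\<close>).

  A function bounded by 1 satisfies \<open>\<bar>b2\<bar> \<le> 1 - \<bar>b1\<bar>\<^sup>2\<close> and \<open>\<bar>b3\<bar> \<le> 1 - \<bar>b1\<bar>\<^sup>2\<close>
  (\<open>first_nonconstant_coeff_bound\<close>, \<open>second_coeff_bound\<close>), and with these two inequalities the triangle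
  inequality alone gives \<open>\<bar>A2\<bar>, \<bar>A3\<bar>, \<bar>A4\<bar> \<le> 1\<close> and \<open>\<bar>A2\<^sup>2 - 2 * A3\<^sup>2 + A2 * A4\<bar> \<le> 2\<close>
  (\<open>inverse_coeff_polynomial_bounds\<close>). The three determinants are \<open>A2\<^sup>2 - A3\<^sup>2\<close>, \<open>A3\<^sup>2 - A4\<^sup>2\<close> and
  \<open>(A2 - A4) * (A2\<^sup>2 - 2 * A3\<^sup>2 + A2 * A4)\<close>, so the bounds 2, 2 and 4 follow. The map \<open>z / (1 - \<i> * z)\<close>, for
  which \<open>\<psi>\<close> is the constant \<open>\<i>\<close>, attains all of them.

  It also has to be shown that the inverse over the whole disc is, near 0, the local inverse of \<open>f\<close>,
  so that its Taylor coefficients are those of the inverse power series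
  (\<open>disc_inverse_local\<close>). Convexity implies starlikeness, hence \<open>\<bar>f\<bar>\<close> does not decrease along rays from
  the origin; a small value can therefore only be taken near the origin, where \<open>f\<close> is injective.
\<close>

section \<open>Coefficients of functions bounded by 1\<close>

lemma holomorphic_on_disc_has_fps_expansion:
  assumes "h holomorphic_on ball 0 1"
  shows "h has_fps_expansion fps_expansion h 0"
  using assms by (intro analytic_at_imp_has_fps_expansion_0)
    (auto simp: analytic_at intro!: exI[of _ "ball 0 1"])

text \<open>The function need not extend continuously to the unit circle, so Cauchy's inequality is applied
  on circles of radius \<open>r < 1\<close> and \<open>r\<close> tends to 1.\<close>

lemma coeff_le_1_if_bounded_by_1:
  assumes holo: "h holomorphic_on ball 0 1"
    and bounded: "\<And>z. norm z < 1 \<Longrightarrow> norm (h z) \<le> 1"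
    and expansion: "h has_fps_expansion H"
  shows "norm (fps_nth H n) \<le> 1"
proof -
  have scaled: "norm (fps_nth H n) * r ^ n \<le> 1" if "0 < r" "r < 1" for r :: real
  proof -
    have "norm ((deriv ^^ n) h 0) \<le> fact n * 1 / r ^ n"
    proof (rule Cauchy_inequality)
      show "h holomorphic_on ball 0 r"
        by (rule holomorphic_on_subset [OF holo]) (use that in auto)
      show "continuous_on (cball 0 r) h"
        by (rule holomorphic_on_imp_continuous_on [OF holomorphic_on_subset [OF holo]])
          (use that in auto)
    qed (use that bounded in auto)
    then show ?thesis
      using that by (simp add: fps_nth_fps_expansion [OF expansion] norm_divide field_simps)
  qed
  have "((\<lambda>r. norm (fps_nth H n) * r ^ n) \<longlongrightarrow> norm (fps_nth H n) * 1 ^ n) (at_left (1::real))"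
    by (intro tendsto_intros)
  moreover have "eventually (\<lambda>r. norm (fps_nth H n) * r ^ n \<le> 1) (at_left (1::real))"
    using eventually_at_left_real [of 0 "1::real"]
    by (rule eventually_mono) (auto intro: scaled)
  ultimately show ?thesis
    using tendsto_upperbound [of _ _ "at_left (1::real)" 1] by fastforce
qed

lemma disc_automorphism_norm_le_1:
  fixes a w :: complex
  assumes "norm a < 1" "norm w \<le> 1"
  shows "norm ((w - a) / (1 - cnj a * w)) \<le> 1" and "1 - cnj a * w \<noteq> 0"
proof -
  have "norm (cnj a * w) \<le> norm a"
    using assms by (simp add: norm_mult mult_left_le)
  then have "norm (cnj a * w) < 1" using assms by linarith
  then show "1 - cnj a * w \<noteq> 0" by auto
  have "(norm (1 - cnj a * w))\<^sup>2 - (norm (w - a))\<^sup>2 = (1 - (norm a)\<^sup>2) * (1 - (norm w)\<^sup>2)"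
    unfolding cmod_power2 by (simp add: power2_eq_square algebra_simps)
  also have "\<dots> \<ge> 0"
    using assms by (intro mult_nonneg_nonneg) (auto simp: power_le_one)
  finally have "(norm (w - a))\<^sup>2 \<le> (norm (1 - cnj a * w))\<^sup>2"
    by simp
  then have "norm (w - a) \<le> norm (1 - cnj a * w)"
    by (rule power2_le_imp_le) simp
  then show "norm ((w - a) / (1 - cnj a * w)) \<le> 1"
    by (simp add: norm_divide divide_le_eq_1)
qed

text \<open>Let \<open>a\<close> be the constant term. Following \<open>h\<close> by the disc automorphism \<open>w \<mapsto> (w - a) / (1 - cnj a * w)\<close>
  gives another function bounded by 1. Because the coefficients of \<open>h\<close> strictly between 0 and \<open>n\<close>
  vanish, its \<open>n\<close>-th coefficient is that of \<open>h\<close> divided by \<open>1 - \<bar>a\<bar>\<^sup>2\<close>, and Cauchy's inequality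
  applies to it. For \<open>n = 1\<close> this is the Schwarz--Pick inequality at the origin.\<close>

lemma first_nonconstant_coeff_bound:
  assumes holo: "h holomorphic_on ball 0 1"
    and bounded: "\<And>z. norm z < 1 \<Longrightarrow> norm (h z) \<le> 1"
    and expansion: "h has_fps_expansion H"
    and "n > 0" and gap: "\<And>k. 0 < k \<Longrightarrow> k < n \<Longrightarrow> fps_nth H k = 0"
  shows "norm (fps_nth H n) \<le> 1 - (norm (fps_nth H 0))\<^sup>2"
proof -
  define a where "a = fps_nth H 0"
  have h0: "h 0 = a"
    using has_fps_expansion_imp_0_eq_fps_nth_0 [OF expansion] by (simp add: a_def)
  show ?thesis
  proof (cases "norm a < 1")
    case True
    define \<phi> where "\<phi> z = (h z - a) / (1 - cnj a * h z)" for z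
    have \<phi>_le: "norm (\<phi> z) \<le> 1" and denom: "1 - cnj a * h z \<noteq> 0" if "norm z < 1" for z
      unfolding \<phi>_def using disc_automorphism_norm_le_1 [OF True bounded [OF that]] by auto
    have \<phi>_holo: "\<phi> holomorphic_on ball 0 1"
      unfolding \<phi>_def using denom by (intro holomorphic_intros holo) auto
    define E where "E = fps_expansion \<phi> 0"
    have E: "\<phi> has_fps_expansion E"
      unfolding E_def by (rule holomorphic_on_disc_has_fps_expansion [OF \<phi>_holo])
    have "(\<lambda>z. \<phi> z * (1 - cnj a * h z)) has_fps_expansion E * (1 - fps_const (cnj a) * H)"
      by (intro fps_expansion_intros E expansion)
    moreover have "(\<lambda>z. \<phi> z * (1 - cnj a * h z)) has_fps_expansion H - fps_const a"
    proof (subst has_fps_expansion_cong)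
      have "eventually (\<lambda>z. z \<in> ball (0::complex) 1) (nhds 0)"
        by (intro eventually_nhds_in_open) auto
      then show "\<forall>\<^sub>F z in nhds 0. \<phi> z * (1 - cnj a * h z) = h z - a"
        by (rule eventually_mono) (use denom in \<open>auto simp: \<phi>_def\<close>)
      show "(\<lambda>z. h z - a) has_fps_expansion H - fps_const a"
        by (intro fps_expansion_intros expansion)
    qed auto
    ultimately have eq: "E * (1 - fps_const (cnj a) * H) = H - fps_const a"
      by (rule fps_expansion_unique_complex)
    have E0: "fps_nth E 0 = 0"
      using has_fps_expansion_imp_0_eq_fps_nth_0 [OF E] h0 by (simp add: \<phi>_def)
    \<comment> \<open>Of the convolution sum only the term \<open>i = n\<close> survives: \<open>E\<close> has no constant term, and the gap in
      \<open>H\<close> kills the terms with \<open>0 < i < n\<close>.\<close>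
    have "fps_nth H n = fps_nth (E * (1 - fps_const (cnj a) * H)) n"
      unfolding eq using \<open>n > 0\<close> by simp
    also have "\<dots> = (\<Sum>i=0..n. if i = n then fps_nth E n * (1 - cnj a * a) else 0)"
      unfolding fps_mult_nth
    proof (intro sum.cong refl)
      fix i assume "i \<in> {0..n}"
      then consider "i = n" | "i = 0" "i < n" | "0 < n - i" "n - i < n" by fastforce
      then show "fps_nth E i * fps_nth (1 - fps_const (cnj a) * H) (n - i)
          = (if i = n then fps_nth E n * (1 - cnj a * a) else 0)"
        by cases (auto simp: E0 gap a_def)
    qed
    also have "\<dots> = fps_nth E n * (1 - cnj a * a)" by simp
    also have "1 - cnj a * a = complex_of_real (1 - (norm a)\<^sup>2)"
      using complex_norm_square [of a] by (simp add: mult.commute)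
    finally have "norm (fps_nth H n) = norm (fps_nth E n) * \<bar>1 - (norm a)\<^sup>2\<bar>"
      by (simp only: norm_mult norm_of_real)
    also have "\<dots> = norm (fps_nth E n) * (1 - (norm a)\<^sup>2)"
      using True by (simp add: power_le_one)
    also have "\<dots> \<le> 1 * (1 - (norm a)\<^sup>2)"
      using True coeff_le_1_if_bounded_by_1 [OF \<phi>_holo \<phi>_le E]
      by (intro mult_right_mono) (auto simp: power_le_one)
    finally show ?thesis by (simp add: a_def)
  next
    case False
    \<comment> \<open>Now \<open>\<bar>a\<bar> = 1\<close>, so the bound 1 is attained at the centre of the disc.\<close>
    have "h constant_on ball 0 1"
    proof (rule maximum_modulus_principle [OF holo, of "ball 0 1" 0])
      show "norm (h z) \<le> norm (h 0)" if "z \<in> ball 0 1" for z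
        using bounded [of z] that False h0 by simp
    qed auto
    then have "eventually (\<lambda>z. h z = a) (nhds 0)"
      using h0 eventually_nhds_in_open [of "ball (0::complex) 1" 0]
      by (auto simp: constant_on_def elim!: eventually_mono)
    then have "(\<lambda>z. h z) has_fps_expansion H \<longleftrightarrow> (\<lambda>z. a) has_fps_expansion H"
      by (intro has_fps_expansion_cong) auto
    with expansion have "H = fps_const a"
      using fps_expansion_unique_complex [OF _ has_fps_expansion_const [of a]] by auto
    moreover have "norm a = 1"
      using False bounded [of 0] h0 by simp
    ultimately show ?thesis
      using \<open>n > 0\<close> by simp
  qed
qed

text \<open>The even part of a function bounded by 1 is bounded by 1, has no linear term, and has the same
  constant and quadratic coefficients.\<close>

lemma second_coeff_bound:
  assumes holo: "h holomorphic_on ball 0 1"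
    and bounded: "\<And>z. norm z < 1 \<Longrightarrow> norm (h z) \<le> 1"
    and expansion: "h has_fps_expansion H"
  shows "norm (fps_nth H 2) \<le> 1 - (norm (fps_nth H 0))\<^sup>2"
proof -
  define e where "e z = (1/2) * (h z + (h \<circ> uminus) z)" for z
  define G where "G = fps_const (1/2) * (H + fps_compose H (- fps_X))"
  have "uminus has_fps_expansion (- fps_X :: complex fps)"
    by (rule has_fps_expansion_minus [OF has_fps_expansion_fps_X])
  then have "(h \<circ> uminus) has_fps_expansion fps_compose H (- fps_X)"
    by (rule has_fps_expansion_compose [OF expansion]) simp
  then have e_G: "e has_fps_expansion G"
    unfolding e_def G_def by (intro has_fps_expansion_cmult_left has_fps_expansion_add expansion)
  have "(h \<circ> uminus) holomorphic_on ball 0 1"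
    by (rule holomorphic_on_compose_gen [OF _ holo]) (auto intro: holomorphic_on_minus)
  then have e_holo: "e holomorphic_on ball 0 1"
    unfolding e_def by (intro holomorphic_on_mult holomorphic_on_add holomorphic_on_const holo)
  have e_le: "norm (e z) \<le> 1" if "norm z < 1" for z
    using norm_triangle_ineq [of "h z" "h (- z)"] bounded [of z] bounded [of "- z"] that
    by (simp add: e_def norm_mult)
  have G_nth: "fps_nth G k = (if even k then fps_nth H k else 0)" for k
    by (simp add: G_def fps_compose_uminus')
  have "fps_nth G k = 0" if "0 < k" "k < 2" for k
  proof -
    have "k = 1" using that by simp
    then show ?thesis by (simp add: G_nth)
  qed
  then have "norm (fps_nth G 2) \<le> 1 - (norm (fps_nth G 0))\<^sup>2"
    by (intro first_nonconstant_coeff_bound [OF e_holo e_le e_G]) simp_all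
  then show ?thesis by (simp add: G_nth)
qed

section \<open>Convex functions and their inverses near the origin\<close>

lemma convex_classD:
  assumes "f \<in> convex_class"
  shows "f holomorphic_on ball 0 1" "f 0 = 0" "deriv f 0 = 1"
    "\<And>z. norm z < 1 \<Longrightarrow> deriv f z \<noteq> 0"
    "\<And>z. norm z < 1 \<Longrightarrow> Re (1 + z * deriv (deriv f) z / deriv f z) > 0"
  using assms by (auto simp: convex_class_def normalized_class_def analytic_imp_holomorphic)

text \<open>If \<open>Re q\<close> fails to be positive, let \<open>z0\<close> be a point of smallest modulus with \<open>Re (q z0) \<le> 0\<close>. Moving from
  \<open>z0\<close> into the smaller disc increases \<open>Re q\<close>; applied to every inward direction, this forces
  \<open>z0 * deriv q z0\<close> to be real and nonpositive. The equation then makes \<open>P z0 * q z0\<close> a positive real, so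
  that \<open>Re (P z0)\<close> and \<open>Re (q z0)\<close> have the same sign, which is impossible.\<close>

lemma Re_pos_if_first_order_ode:
  fixes q P :: "complex \<Rightarrow> complex"
  assumes holo: "q holomorphic_on ball 0 1"
    and q0: "Re (q 0) > 0"
    and P: "\<And>z. norm z < 1 \<Longrightarrow> Re (P z) > 0"
    and ode: "\<And>z. norm z < 1 \<Longrightarrow> P z * q z + z * deriv q z = 1"
    and "norm z < 1"
  shows "Re (q z) > 0"
proof (rule ccontr)
  assume neg: "\<not> Re (q z) > 0"
  define K where "K = cball 0 (norm z) \<inter> (\<lambda>w. Re (q w)) -` {..0}"
  have cont: "continuous_on (cball 0 (norm z)) (\<lambda>w. Re (q w))"
    using \<open>norm z < 1\<close>
    by (intro continuous_intros holomorphic_on_imp_continuous_on holomorphic_on_subset [OF holo]) auto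
  have "closed K"
    unfolding K_def by (intro continuous_closed_preimage cont) auto
  then have "compact K"
    using compact_Int_closed [OF compact_cball, of K 0 "norm z"] by (simp add: K_def inf_left_commute inf.absorb_iff2)
  moreover have "z \<in> K"
    using neg by (auto simp: K_def)
  ultimately obtain z0 where "z0 \<in> K" and min: "\<And>w. w \<in> K \<Longrightarrow> norm z0 \<le> norm w"
    using continuous_attains_inf [of K norm] by (metis continuous_on_norm_id empty_iff)
  have z0: "norm z0 < 1" "Re (q z0) \<le> 0" "norm z0 \<le> norm z"
    using \<open>z0 \<in> K\<close> \<open>norm z < 1\<close> by (auto simp: K_def)
  have "z0 \<noteq> 0" using z0 q0 by auto
  have inside: "Re (q w) > 0" if "norm w < norm z0" for w
    using min [of w] that z0 by (force simp: K_def)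
  define L where "L = z0 * deriv q z0"
  \<comment> \<open>The directions \<open>v * z0\<close> with \<open>Re v < 0\<close> are those that point into the disc of radius \<open>\<bar>z0\<bar>\<close>.\<close>
  have half_plane: "Re (v * L) \<ge> 0" if v: "Re v < 0" for v
  proof (rule ccontr)
    assume "\<not> Re (v * L) \<ge> 0"
    have "(q has_field_derivative deriv q z0) (at z0)"
      using holomorphic_derivI [OF holo] z0 by auto
    then have q': "(q has_field_derivative deriv q z0) (at (z0 + of_real 0 * (v * z0)))"
      by simp
    have "((\<lambda>t. q (z0 + of_real t * (v * z0))) has_vector_derivative (v * z0) * deriv q z0) (at 0)"
      by (rule field_vector_diff_chain_at [where f = "\<lambda>t. z0 + of_real t * (v * z0)" and g = q, unfolded o_def, OF _ q'])
        (auto intro!: derivative_eq_intros)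
    then have "((\<lambda>t. Re (q (z0 + of_real t * (v * z0)))) has_vector_derivative Re ((v * z0) * deriv q z0)) (at 0)"
      by (rule bounded_linear.has_vector_derivative [OF bounded_linear_Re])
    then have "((\<lambda>t. Re (q (z0 + of_real t * (v * z0)))) has_real_derivative Re (v * L)) (at 0)"
      by (simp add: L_def has_real_derivative_iff_has_vector_derivative mult.assoc)
    from DERIV_neg_dec_right [OF this] \<open>\<not> Re (v * L) \<ge> 0\<close>
    obtain d where "d > 0" and d: "\<And>t. 0 < t \<Longrightarrow> t < d \<Longrightarrow> Re (q (z0 + of_real t * (v * z0))) < Re (q z0)"
      by (auto simp: not_le)
    have "v \<noteq> 0" using v by auto
    \<comment> \<open>Half of the largest \<open>t\<close> for which \<open>z0 + t * (v * z0)\<close> stays in that disc, or less.\<close>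
    define t where "t = min (d/2) (- Re v / (norm v)\<^sup>2)"
    have t: "0 < t" "t < d" "t \<le> - Re v / (norm v)\<^sup>2"
      using \<open>d > 0\<close> v \<open>v \<noteq> 0\<close> by (auto simp: t_def divide_neg_pos)
    have "(norm (1 + of_real t * v))\<^sup>2 = 1 + t * (2 * Re v + t * (norm v)\<^sup>2)"
      unfolding cmod_power2 by (simp add: power2_eq_square algebra_simps)
    also have "t * (norm v)\<^sup>2 \<le> - Re v"
      using t(3) \<open>v \<noteq> 0\<close> by (simp add: field_simps)
    then have "1 + t * (2 * Re v + t * (norm v)\<^sup>2) < 1\<^sup>2"
      using v t(1) by (simp add: mult_pos_neg)
    finally have "norm (1 + of_real t * v) < 1"
      by (rule power_less_imp_less_base) simp
    moreover have "z0 + of_real t * (v * z0) = z0 * (1 + of_real t * v)"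
      by (simp add: algebra_simps)
    ultimately have "norm (z0 + of_real t * (v * z0)) < norm z0"
      using \<open>z0 \<noteq> 0\<close> by (simp add: norm_mult)
    from inside [OF this] d [OF t(1,2)] z0(2) show False by simp
  qed
  have "Re L \<le> 0"
    using half_plane [of "-1"] by simp
  have "Im L = 0"
  proof (rule ccontr)
    assume "Im L \<noteq> 0"
    \<comment> \<open>This direction gives \<open>Re (v * L) = -1\<close>.\<close>
    then show False
      using half_plane [of "Complex (-1) ((1 - Re L) / Im L)"] by simp
  qed
  have "Re (P z0 * q z0) = 1 - Re L" "Im (P z0 * q z0) = 0"
    using ode [OF z0(1)] \<open>Im L = 0\<close>
    by (auto simp: L_def complex_eq_iff algebra_simps)
  then have Pq: "P z0 * q z0 = of_real (1 - Re L)"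
    by (simp add: complex_eq_iff)
  have "Re (P z0) * (norm (q z0))\<^sup>2 = Re (P z0 * q z0 * cnj (q z0))"
    unfolding mult.assoc complex_norm_square [symmetric] by simp
  also have "\<dots> = (1 - Re L) * Re (q z0)"
    unfolding Pq by simp
  also have "\<dots> \<le> 0"
    using \<open>Re L \<le> 0\<close> z0(2) by (intro mult_nonneg_nonpos) auto
  finally have "q z0 = 0"
    using P [OF z0(1)] by (simp add: mult_le_0_iff)
  with Pq show False
    using \<open>Re L \<le> 0\<close> by (simp add: complex_eq_iff)
qed

text \<open>Convexity implies starlikeness. The quotient \<open>q z = f z / (z * f' z)\<close> is used rather than its
  reciprocal because it is holomorphic on the whole disc without knowing that \<open>f\<close> has no zero but
  the origin. Differentiating \<open>f z = z * f' z * q z\<close> gives \<open>P z * q z + z * q' z = 1\<close> with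
  \<open>P z = 1 + z * f'' z / f' z\<close>, so \<open>Re q\<close> inherits positivity from \<open>Re P\<close>. The conclusion is written as a
  product, which is the form in which the derivative of \<open>\<bar>f\<bar>\<^sup>2\<close> along a ray appears.\<close>

lemma convex_imp_starlike:
  assumes f: "f \<in> convex_class" and "norm z < 1"
  shows "Re (cnj (f z) * (z * deriv f z)) \<ge> 0"
proof -
  note fD = convex_classD [OF f]
  obtain h where h: "h holomorphic_on ball 0 1" "\<And>z. norm z < 1 \<Longrightarrow> f z = z * h z" "deriv f 0 = h 0"
    using Schwarz3 [OF fD(1,2)] by blast
  have f': "deriv f holomorphic_on ball 0 1"
    by (intro holomorphic_intros fD) auto
  define q where "q z = h z / deriv f z" for z
  have q: "q holomorphic_on ball 0 1"
    unfolding q_def using fD(4) by (intro holomorphic_intros h f') auto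
  have fq: "f w = w * deriv f w * q w" if "norm w < 1" for w
    using that fD(4) [OF that] h(2) by (simp add: q_def)
  have "Re (q z) > 0"
  proof (rule Re_pos_if_first_order_ode [OF q])
    show "Re (q 0) > 0"
      using h(3) fD(3) by (simp add: q_def)
    show "Re (1 + w * deriv (deriv f) w / deriv f w) > 0" if "norm w < 1" for w
      by (rule fD(5) [OF that])
    fix w :: complex assume w: "norm w < 1"
    have f'': "(deriv f has_field_derivative deriv (deriv f) w) (at w)"
      using holomorphic_derivI [OF f'] w by auto
    have "(q has_field_derivative deriv q w) (at w)"
      using holomorphic_derivI [OF q] w by auto
    with f'' have "((\<lambda>w. w * deriv f w * q w) has_field_derivative
        (deriv f w + w * deriv (deriv f) w) * q w + w * deriv f w * deriv q w) (at w)"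
      by (auto intro!: derivative_eq_intros simp: algebra_simps)
    then have "(f has_field_derivative
        (deriv f w + w * deriv (deriv f) w) * q w + w * deriv f w * deriv q w) (at w)"
      by (rule has_field_derivative_transform_within_open [where S = "ball 0 1"])
        (use w fq in auto)
    then have "deriv f w = (deriv f w + w * deriv (deriv f) w) * q w + w * deriv f w * deriv q w"
      by (rule DERIV_imp_deriv)
    then show "(1 + w * deriv (deriv f) w / deriv f w) * q w + w * deriv q w = 1"
      using fD(4) [OF w] by (simp add: field_simps)
  qed fact
  moreover have "cnj (f z) * (z * deriv f z) = of_real ((norm (z * deriv f z))\<^sup>2) * cnj (q z)"
    unfolding complex_norm_square fq [OF \<open>norm z < 1\<close>] by simp
  ultimately show ?thesis by simp
qed

text \<open>Up to the factor \<open>2 / t\<close>, the derivative of \<open>\<bar>f (t * z)\<bar>\<^sup>2\<close> in \<open>t\<close> is the quantity that starlikeness makes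
  nonnegative.\<close>

lemma convex_norm_mono_on_rays:
  assumes f: "f \<in> convex_class" and "norm z < 1" and "0 \<le> s" "s \<le> 1"
  shows "norm (f (of_real s * z)) \<le> norm (f z)"
proof -
  note fD = convex_classD [OF f]
  define g where "g t = f (of_real t * z)" for t
  have "(Re (g s))\<^sup>2 + (Im (g s))\<^sup>2 \<le> (Re (g 1))\<^sup>2 + (Im (g 1))\<^sup>2"
  proof (rule DERIV_nonneg_imp_nondecreasing [where f = "\<lambda>t. (Re (g t))\<^sup>2 + (Im (g t))\<^sup>2", OF \<open>s \<le> 1\<close>])
    fix t assume t: "s \<le> t" "t \<le> 1"
    have "t * norm z \<le> norm z"
      using t \<open>0 \<le> s\<close> by (simp add: mult_left_le_one_le)
    then have tz: "norm (of_real t * z) < 1"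
      using t \<open>0 \<le> s\<close> \<open>norm z < 1\<close> by (simp add: norm_mult)
    have f': "(f has_field_derivative deriv f (of_real t * z)) (at (of_real t * z))"
      using holomorphic_derivI [OF fD(1)] tz by auto
    have g': "(g has_vector_derivative z * deriv f (of_real t * z)) (at t)"
      unfolding g_def
      by (rule field_vector_diff_chain_at [where f = "\<lambda>t. of_real t * z" and g = f, unfolded o_def, OF _ f'])
        (auto intro!: derivative_eq_intros)
    define D where "D = z * deriv f (of_real t * z)"
    have d: "((\<lambda>t. Re (g t)) has_real_derivative Re D) (at t)"
      "((\<lambda>t. Im (g t)) has_real_derivative Im D) (at t)"
      using bounded_linear.has_vector_derivative [OF bounded_linear_Re g']
        bounded_linear.has_vector_derivative [OF bounded_linear_Im g']
      by (simp_all add: D_def has_real_derivative_iff_has_vector_derivative)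
    have "((\<lambda>t. (Re (g t))\<^sup>2 + (Im (g t))\<^sup>2) has_real_derivative 2 * Re (cnj (g t) * D)) (at t)"
      using DERIV_add [OF DERIV_power [OF d(1), of 2] DERIV_power [OF d(2), of 2]]
      by (simp add: algebra_simps)
    moreover have "Re (cnj (g t) * D) \<ge> 0"
    proof (cases "t = 0")
      case True
      then show ?thesis using fD(2) by (simp add: g_def)
    next
      case False
      then have "t > 0" using t \<open>0 \<le> s\<close> by simp
      moreover have "t * Re (cnj (g t) * D) \<ge> 0"
        using convex_imp_starlike [OF f tz] by (simp add: g_def D_def algebra_simps)
      ultimately show ?thesis by (simp add: zero_le_mult_iff)
    qed
    ultimately show "\<exists>y. ((\<lambda>t. (Re (g t))\<^sup>2 + (Im (g t))\<^sup>2) has_real_derivative y) (at t) \<and> y \<ge> 0"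
      by (metis mult_nonneg_nonneg zero_le_numeral)
  qed
  then show ?thesis
    by (simp add: g_def cmod_def)
qed

text \<open>The inverse taken over the whole disc coincides near 0 with a local inverse of \<open>f\<close> once it is
  known that no point far from the origin has a small image. That follows from the monotonicity
  of \<open>\<bar>f\<bar>\<close> on rays: outside the disc of radius \<open>d\<close>, \<open>\<bar>f\<bar>\<close> is at least its minimum on the circle of
  radius \<open>d\<close>.\<close>

lemma disc_inverse_local:
  assumes f: "f \<in> convex_class"
  shows "disc_inverse f analytic_on {0}" "disc_inverse f 0 = 0"
    "eventually (\<lambda>w. f (disc_inverse f w) = w) (nhds 0)"
proof -
  note fD = convex_classD [OF f]
  obtain r where r: "r > 0" "ball 0 r \<subseteq> ball (0::complex) 1" "inj_on f (ball 0 r)"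
    using has_complex_derivative_locally_injective [OF fD(1), of 0] fD(3) by auto
  have holo_r: "f holomorphic_on ball 0 r"
    by (rule holomorphic_on_subset [OF fD(1) r(2)])
  obtain g where g: "g holomorphic_on f ` ball 0 r" "\<And>z. z \<in> ball 0 r \<Longrightarrow> g (f z) = z"
    
    by (rule holomorphic_has_inverse [OF holo_r open_ball r(3)]) (rule that)
  define d where "d = r / 2"
  have "r \<le> 1" using r(1,2) ball_subset_ball_iff [of "0::complex" r 0 1] by auto
  have d: "0 < d" "d < r" "d < 1" using r(1) \<open>r \<le> 1\<close> by (auto simp: d_def)
  have nz: "f z \<noteq> 0" if "z \<in> sphere 0 d" for z
  proof
    assume "f z = 0"
    then have "z = 0"
      using inj_onD [OF r(3), of z 0] that d fD(2) r(1) by auto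
    then show False using that d by simp
  qed
  have "continuous_on (sphere 0 d) (\<lambda>z. norm (f z))"
    using d by (intro continuous_intros holomorphic_on_imp_continuous_on
        holomorphic_on_subset [OF fD(1)]) auto
  moreover have "sphere (0::complex) d \<noteq> {}"
    using d by simp
  ultimately obtain z1 where z1: "z1 \<in> sphere 0 d"
      and z1_min: "\<And>z. z \<in> sphere 0 d \<Longrightarrow> norm (f z1) \<le> norm (f z)"
    using continuous_attains_inf [of "sphere (0::complex) d" "\<lambda>z. norm (f z)"] by auto
  define m where "m = norm (f z1)"
  have "m > 0" using nz [OF z1] by (simp add: m_def)
  have far: "norm (f z) \<ge> m" if "norm z < 1" "d \<le> norm z" for z
  proof -
    \<comment> \<open>Compare \<open>z\<close> with the point of the circle of radius \<open>d\<close> on the same ray.\<close>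
    have "m \<le> norm (f (of_real (d / norm z) * z))"
      unfolding m_def using that d by (intro z1_min) (auto simp: norm_mult norm_divide)
    also have "\<dots> \<le> norm (f z)"
      using that d by (intro convex_norm_mono_on_rays [OF f]) (auto simp: divide_le_eq_1)
    finally show ?thesis .
  qed
  define S where "S = f ` ball 0 r \<inter> ball 0 m"
  have "open (f ` ball 0 r)"
    using open_mapping_thm3 [OF holo_r open_ball r(3)] .
  then have "open S" by (auto simp: S_def)
  have "f 0 \<in> f ` ball 0 r" using r(1) by (intro imageI) auto
  then have "0 \<in> S" using fD(2) \<open>m > 0\<close> by (simp add: S_def)
  have inv: "disc_inverse f w = g w \<and> f (g w) = w" if "w \<in> S" for w
  proof -
    obtain z where z: "z \<in> ball 0 r" "w = f z" using \<open>w \<in> S\<close> by (auto simp: S_def)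
    have "y = z" if "y \<in> ball 0 1" "f y = w" for y
    proof -
      have "norm y < d"
        using far [of y] that \<open>w \<in> S\<close> by (force simp: S_def)
      then show ?thesis
        using inj_onD [OF r(3), of y z] that z d by auto
    qed
    moreover have "z \<in> ball 0 1" using z r(2) by blast
    ultimately have "disc_inverse f w = z"
      unfolding disc_inverse_def the_inv_into_def using z(2) by (intro the_equality) auto
    then show ?thesis using g(2) z by auto
  qed
  have "g holomorphic_on S"
    by (rule holomorphic_on_subset [OF g(1)]) (auto simp: S_def)
  then have "disc_inverse f holomorphic_on S"
    by (rule holomorphic_transform) (use inv in auto)
  then show "disc_inverse f analytic_on {0}"
    using \<open>open S\<close> \<open>0 \<in> S\<close> analytic_at by blast
  show "disc_inverse f 0 = 0"
    using inv [OF \<open>0 \<in> S\<close>] g(2) [of 0] r(1) fD(2) by simp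
  show "eventually (\<lambda>w. f (disc_inverse f w) = w) (nhds 0)"
    using eventually_nhds_in_open [OF \<open>open S\<close> \<open>0 \<in> S\<close>]
    by (rule eventually_mono) (use inv in auto)
qed

section \<open>Coefficients of the inverse\<close>

text \<open>The coefficients of \<open>X\<^sup>2\<close>, \<open>X\<^sup>3\<close> and \<open>X\<^sup>4\<close> in the composition vanish.\<close>

lemma inverse_fps_coeffs:
  fixes F G :: "'a :: comm_ring_1 fps"
  assumes F: "fps_nth F 0 = 0" "fps_nth F 1 = 1"
    and G0: "fps_nth G 0 = 0"
    and inverse: "fps_compose F G = fps_X"
  shows "fps_nth G 2 = - fps_nth F 2"
    and "fps_nth G 3 = 2 * (fps_nth F 2)\<^sup>2 - fps_nth F 3"
    and "fps_nth G 4 = - 5 * (fps_nth F 2) ^ 3 + 5 * fps_nth F 2 * fps_nth F 3 - fps_nth F 4"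
proof -
  define a2 a3 a4 where a_def: "a2 = fps_nth F 2" "a3 = fps_nth F 3" "a4 = fps_nth F 4"
  define A2 A3 A4 where A_def: "A2 = fps_nth G 2" "A3 = fps_nth G 3" "A4 = fps_nth G 4"
  have Fn: "fps_nth F 0 = 0" "fps_nth F (Suc 0) = 1" "fps_nth F (Suc (Suc 0)) = a2"
    "fps_nth F (Suc (Suc (Suc 0))) = a3" "fps_nth F (Suc (Suc (Suc (Suc 0)))) = a4"
    using F by (simp_all add: a_def eval_nat_numeral)
  have comp: "(\<Sum>i=0..n. fps_nth F i * fps_nth (G ^ i) n) = (if n = 1 then 1 else 0)" for n
    using arg_cong [OF inverse, of "\<lambda>S. fps_nth S n"] by (simp add: fps_compose_nth)
  have G1: "fps_nth G (Suc 0) = 1"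
    using comp [of 1] by (simp add: Fn)
  have Gn: "fps_nth G 0 = 0" "fps_nth G (Suc 0) = 1" "fps_nth G (Suc (Suc 0)) = A2"
    "fps_nth G (Suc (Suc (Suc 0))) = A3" "fps_nth G (Suc (Suc (Suc (Suc 0)))) = A4"
    using G0 G1 by (simp_all add: A_def eval_nat_numeral)
  note expand = fps_mult_nth Fn Gn sum.atLeast0_atMost_Suc numeral_eq_Suc
  have 2: "A2 + a2 = 0"
    using comp [of 2] by (simp add: expand)
  have 3: "A3 + 2 * a2 * A2 + a3 = 0"
    using comp [of 3] by (simp add: expand algebra_simps)
  have 4: "A4 + a2 * (A2\<^sup>2 + 2 * A3) + 3 * a3 * A2 + a4 = 0"
    using comp [of 4] by (simp add: expand algebra_simps)
  have A2: "A2 = - a2" using 2 by (simp add: add_eq_0_iff)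
  have A3: "A3 = 2 * a2\<^sup>2 - a3" using 3 unfolding A2 by (simp add: algebra_simps power2_eq_square add_eq_0_iff)
  have "A4 = - (a2 * (A2\<^sup>2 + 2 * A3) + 3 * a3 * A2 + a4)"
    using 4 by (simp only: eq_neg_iff_add_eq_0 add.assoc)
  also have "\<dots> = - 5 * a2 ^ 3 + 5 * a2 * a3 - a4"
    unfolding A2 A3 by (simp add: algebra_simps power2_eq_square power3_eq_cube)
  finally show "fps_nth G 2 = - fps_nth F 2"
    "fps_nth G 3 = 2 * (fps_nth F 2)\<^sup>2 - fps_nth F 3"
    "fps_nth G 4 = - 5 * (fps_nth F 2) ^ 3 + 5 * fps_nth F 2 * fps_nth F 3 - fps_nth F 4"
    using A2 A3 by (simp_all add: a_def A_def)
qed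

text \<open>The Cayley transform \<open>(P - 1) / (P + 1)\<close> of \<open>P z = 1 + z * f'' z / f' z\<close>, divided by \<open>z\<close>. The factor \<open>z\<close>
  is cancelled in the formula, so there is no singularity to remove at the origin.\<close>

definition schwarz_quotient :: "(complex \<Rightarrow> complex) \<Rightarrow> complex \<Rightarrow> complex" where
  "schwarz_quotient f z = deriv (deriv f) z / (2 * deriv f z + z * deriv (deriv f) z)"

lemma schwarz_quotient_denominator:
  assumes f: "f \<in> convex_class" and "norm z < 1"
  shows "2 * deriv f z + z * deriv (deriv f) z \<noteq> 0"
proof
  assume "2 * deriv f z + z * deriv (deriv f) z = 0"
  then have "z * deriv (deriv f) z / deriv f z = - 2"
    using convex_classD(4) [OF assms] by (simp add: field_simps eq_neg_iff_add_eq_0)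
  then show False
    using convex_classD(5) [OF assms] by simp
qed

lemma schwarz_quotient_holomorphic:
  assumes f: "f \<in> convex_class"
  shows "schwarz_quotient f holomorphic_on ball 0 1"
  unfolding schwarz_quotient_def
  using schwarz_quotient_denominator [OF f]
  by (intro holomorphic_intros convex_classD(1) [OF f]) auto

text \<open>For convex \<open>f\<close> the Cayley transform maps the disc to itself and fixes 0, so the Schwarz lemma
  applies to it.\<close>

lemma schwarz_quotient_bounded:
  assumes f: "f \<in> convex_class" and z: "norm z < 1"
  shows "norm (schwarz_quotient f z) \<le> 1"
proof -
  define \<omega> where "\<omega> w = w * schwarz_quotient f w" for w
  have holo: "\<omega> holomorphic_on ball 0 1"
    unfolding \<omega>_def by (intro holomorphic_intros schwarz_quotient_holomorphic [OF f])
  have \<omega>0: "\<omega> 0 = 0" by (simp add: \<omega>_def)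
  have less: "norm (\<omega> w) < 1" if w: "norm w < 1" for w
  proof -
    define p where "p = 1 + w * deriv (deriv f) w / deriv f w"
    have "Re p > 0"
      using convex_classD(5) [OF f w] by (simp add: p_def)
    then have "p + 1 \<noteq> 0" by (auto simp: complex_eq_iff)
    have "2 * deriv f w + w * deriv (deriv f) w = deriv f w * (p + 1)"
      "w * deriv (deriv f) w = deriv f w * (p - 1)"
      using convex_classD(4) [OF f w] by (simp_all add: p_def field_simps)
    then have "\<omega> w = (p - 1) / (p + 1)"
      using convex_classD(4) [OF f w] by (simp add: \<omega>_def schwarz_quotient_def)
    moreover have "(norm (p - 1))\<^sup>2 < (norm (p + 1))\<^sup>2"
      unfolding cmod_power2 using \<open>Re p > 0\<close> by (simp add: power2_eq_square algebra_simps)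
    then have "norm (p - 1) < norm (p + 1)"
      by (rule power_less_imp_less_base) simp
    ultimately show ?thesis
      using \<open>p + 1 \<noteq> 0\<close> by (simp add: norm_divide)
  qed
  show ?thesis
  proof (cases "z = 0")
    case True
    have "(schwarz_quotient f has_field_derivative deriv (schwarz_quotient f) 0) (at 0)"
      using holomorphic_derivI [OF schwarz_quotient_holomorphic [OF f]] by auto
    then have "(\<omega> has_field_derivative schwarz_quotient f 0) (at 0)"
      unfolding \<omega>_def by (auto intro!: derivative_eq_intros)
    then show ?thesis
      using Schwarz_Lemma(2) [OF holo \<omega>0 less z] True by (simp add: DERIV_imp_deriv)
  next
    case False
    then show ?thesis
      using Schwarz_Lemma(1) [OF holo \<omega>0 less z] by (simp add: \<omega>_def norm_mult)
  qed
qed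

text \<open>Comparing coefficients in \<open>\<psi> * (2 * f' + z * f'') = f''\<close>, where \<open>\<psi>\<close> is the Schwarz quotient, expresses
  the coefficients of \<open>f\<close> through those of \<open>\<psi>\<close>; inversion then gives those of the inverse.\<close>

lemma inverse_taylor_coeffs:
  assumes f: "f \<in> convex_class"
    and B: "schwarz_quotient f has_fps_expansion B"
  shows "taylor_coeff (disc_inverse f) 2 = - fps_nth B 0"
    and "taylor_coeff (disc_inverse f) 3 = (fps_nth B 0)\<^sup>2 - fps_nth B 1 / 3"
    and "taylor_coeff (disc_inverse f) 4 =
      - (fps_nth B 0 ^ 3) + 5 / 6 * fps_nth B 0 * fps_nth B 1 - fps_nth B 2 / 6"
proof -
  note fD = convex_classD [OF f]
  define F where "F = fps_expansion f 0"
  define G where "G = fps_expansion (disc_inverse f) 0"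
  have F: "f has_fps_expansion F"
    unfolding F_def by (rule holomorphic_on_disc_has_fps_expansion [OF fD(1)])
  have G: "disc_inverse f has_fps_expansion G"
    unfolding G_def by (intro analytic_at_imp_has_fps_expansion_0 disc_inverse_local [OF f])
  have F01: "fps_nth F 0 = 0" "fps_nth F 1 = 1"
    using fD(2,3) by (simp_all add: fps_nth_fps_expansion [OF F])
  have G0: "fps_nth G 0 = 0"
    using disc_inverse_local(2) [OF f] by (simp add: fps_nth_fps_expansion [OF G])
  have "(f \<circ> disc_inverse f) has_fps_expansion fps_compose F G"
    by (rule has_fps_expansion_compose [OF F G G0])
  moreover have "(f \<circ> disc_inverse f) has_fps_expansion fps_X"
    by (subst has_fps_expansion_cong [where g = "\<lambda>w. w" and G = fps_X])
      (use disc_inverse_local(3) [OF f] has_fps_expansion_fps_X in auto)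
  ultimately have "fps_compose F G = fps_X"
    by (rule fps_expansion_unique_complex)
  note A = inverse_fps_coeffs [OF F01 G0 this]
  have "(\<lambda>z. schwarz_quotient f z * (2 * deriv f z + z * deriv (deriv f) z)) has_fps_expansion
      B * (fps_const 2 * fps_deriv F + fps_X * fps_deriv (fps_deriv F))"
    by (intro fps_expansion_intros B F)
  moreover have "(\<lambda>z. schwarz_quotient f z * (2 * deriv f z + z * deriv (deriv f) z)) has_fps_expansion
      fps_deriv (fps_deriv F)"
  proof (subst has_fps_expansion_cong)
    have "eventually (\<lambda>z. z \<in> ball (0::complex) 1) (nhds 0)"
      by (intro eventually_nhds_in_open) auto
    then show "\<forall>\<^sub>F z in nhds 0. schwarz_quotient f z * (2 * deriv f z + z * deriv (deriv f) z) = deriv (deriv f) z"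
      by (rule eventually_mono)
        (use schwarz_quotient_denominator [OF f] in \<open>auto simp: schwarz_quotient_def\<close>)
    show "deriv (deriv f) has_fps_expansion fps_deriv (fps_deriv F)"
      by (intro fps_expansion_intros F)
  qed auto
  ultimately have "B * (fps_const 2 * fps_deriv F + fps_X * fps_deriv (fps_deriv F)) = fps_deriv (fps_deriv F)"
    by (rule fps_expansion_unique_complex)
  then have eq: "fps_nth (B * (fps_const 2 * fps_deriv F + fps_X * fps_deriv (fps_deriv F))) n
      = fps_nth (fps_deriv (fps_deriv F)) n" for n
    by simp
  define a2 a3 a4 where a_def: "a2 = fps_nth F 2" "a3 = fps_nth F 3" "a4 = fps_nth F 4"
  define b1 b2 b3 where b_def: "b1 = fps_nth B 0" "b2 = fps_nth B 1" "b3 = fps_nth B 2"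
  have Fn: "fps_nth F (Suc 0) = 1" "fps_nth F (Suc (Suc 0)) = a2"
    "fps_nth F (Suc (Suc (Suc 0))) = a3" "fps_nth F (Suc (Suc (Suc (Suc 0)))) = a4"
    using F01 by (simp_all add: a_def eval_nat_numeral)
  have Bn: "fps_nth B 0 = b1" "fps_nth B (Suc 0) = b2" "fps_nth B (Suc (Suc 0)) = b3"
    by (simp_all add: b_def eval_nat_numeral)
  have 0: "2 * b1 = 2 * a2"
    using eq [of 0] by (simp add: Fn Bn)
  have 1: "2 * b2 + 6 * a2 * b1 = 6 * a3"
    using eq [of 1] by (simp add: fps_mult_nth Fn Bn algebra_simps)
  have 2: "2 * b3 + 6 * a2 * b2 + 12 * a3 * b1 = 12 * a4"
    using eq [of "Suc (Suc 0)"]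
    by (simp add: fps_mult_nth sum.atLeast0_atMost_Suc Fn Bn algebra_simps)
  have a2: "a2 = b1" using 0 by simp
  have a3: "a3 = b1\<^sup>2 + b2 / 3"
  proof -
    have "6 * a3 = 6 * (b1\<^sup>2 + b2 / 3)"
      using 1 unfolding a2 by (simp add: power2_eq_square algebra_simps)
    then show ?thesis by (simp only: mult_cancel_left) simp
  qed
  have a4: "a4 = b1 ^ 3 + 5 / 6 * b1 * b2 + b3 / 6"
  proof -
    have "12 * a4 = 12 * (b1 ^ 3 + 5 / 6 * b1 * b2 + b3 / 6)"
      using 2 unfolding a2 a3 by (simp add: power2_eq_square power3_eq_cube algebra_simps)
    then show ?thesis by (simp only: mult_cancel_left) simp
  qed
  show "taylor_coeff (disc_inverse f) 2 = - fps_nth B 0"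
    "taylor_coeff (disc_inverse f) 3 = (fps_nth B 0)\<^sup>2 - fps_nth B 1 / 3"
    "taylor_coeff (disc_inverse f) 4 =
      - (fps_nth B 0 ^ 3) + 5 / 6 * fps_nth B 0 * fps_nth B 1 - fps_nth B 2 / 6"
    unfolding taylor_coeff_def G_def [symmetric] A a_def [symmetric] b_def [symmetric] a4 a3 a2
    by (simp_all add: field_simps power2_eq_square power3_eq_cube)
qed

text \<open>With \<open>s = 1 - \<bar>b1\<bar>\<^sup>2\<close>, every monomial containing \<open>b2\<close> or \<open>b3\<close> is at most \<open>s\<close> in modulus and every power
  of \<open>b1\<close> of exponent at least 2 is at most \<open>1 - s\<close>. The moduli of the coefficients belonging to the
  first kind add up to at most 1 (to 8/9 in the last claim), so the triangle inequality gives a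
  convex combination of admissible values. The last claim needs the expression multiplied out,
  since the \<open>b1 ^ 4\<close> terms of \<open>- 2 * A3\<^sup>2\<close> and \<open>A2 * A4\<close> cancel partially: bounding \<open>A2\<^sup>2\<close>, \<open>2 * A3\<^sup>2\<close> and
  \<open>A2 * A4\<close> separately yields only 4.\<close>

lemma inverse_coeff_polynomial_bounds:
  fixes b1 b2 b3 :: complex
  assumes b1: "norm b1 \<le> 1" and b2: "norm b2 \<le> 1 - (norm b1)\<^sup>2" and b3: "norm b3 \<le> 1 - (norm b1)\<^sup>2"
  defines "A2 \<equiv> - b1" and "A3 \<equiv> b1\<^sup>2 - b2 / 3" and "A4 \<equiv> - (b1 ^ 3) + 5 / 6 * b1 * b2 - b3 / 6"
  shows "norm A2 \<le> 1" and "norm A3 \<le> 1" and "norm A4 \<le> 1"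
    and "norm (A2\<^sup>2 - 2 * A3\<^sup>2 + A2 * A4) \<le> 2"
proof -
  define r where "r = norm b1"
  define s where "s = 1 - r\<^sup>2"
  have r: "0 \<le> r" "r \<le> 1" using b1 by (auto simp: r_def)
  have s: "0 \<le> s" "s \<le> 1" using r by (auto simp: s_def power_le_one)
  have b2: "norm b2 \<le> s" and b3: "norm b3 \<le> s"
    using b2 b3 by (auto simp: s_def r_def)
  have "norm b1 * norm b2 \<le> 1 * s"
    using r s b2 by (intro mult_mono) (auto simp: r_def)
  then have b12: "norm (b1 * b2) \<le> s" by (simp add: norm_mult)
  have "norm b1 * norm b3 \<le> 1 * s"
    using r s b3 by (intro mult_mono) (auto simp: r_def)
  then have b13: "norm (b1 * b3) \<le> s" by (simp add: norm_mult)
  have "norm b1 * norm (b1 * b2) \<le> 1 * s"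
    using r s b12 by (intro mult_mono) (auto simp: r_def)
  then have b112: "norm (b1\<^sup>2 * b2) \<le> s" by (simp add: norm_mult power2_eq_square)
  have "norm b2 * norm b2 \<le> 1 * s"
    using s b2 by (intro mult_mono) auto
  then have b22: "norm (b2\<^sup>2) \<le> s" by (simp add: norm_mult power2_eq_square)
  have n2: "norm (b1\<^sup>2) = 1 - s" by (simp add: norm_power s_def r_def)
  have "r ^ 3 \<le> r\<^sup>2" "r ^ 4 \<le> r\<^sup>2"
    using r by (auto intro!: power_decreasing)
  then have n3: "norm (b1 ^ 3) \<le> 1 - s" and n4: "norm (b1 ^ 4) \<le> 1 - s"
    by (simp_all add: norm_power s_def r_def)
  show "norm A2 \<le> 1" using b1 by (simp add: A2_def)
  have "norm A3 \<le> norm (b1\<^sup>2) + norm (b2 / 3)"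
    unfolding A3_def by (rule norm_triangle_ineq4)
  then show "norm A3 \<le> 1"
    using n2 b2 s by (simp add: norm_divide)
  have "norm A4 \<le> norm (b1 ^ 3) + norm (5 / 6 * (b1 * b2)) + norm (b3 / 6)"
    unfolding A4_def
    using norm_triangle_ineq4 [of "- (b1 ^ 3) + 5 / 6 * (b1 * b2)" "b3 / 6"]
      norm_triangle_ineq [of "- (b1 ^ 3)" "5 / 6 * (b1 * b2)"] by (simp add: mult.assoc)
  also have "\<dots> = norm (b1 ^ 3) + 5 / 6 * norm (b1 * b2) + norm b3 / 6"
    by (simp only: norm_mult norm_divide norm_numeral)
  also have "\<dots> \<le> 1"
    using n3 b12 b3 s by linarith
  finally show "norm A4 \<le> 1" .
  have "A2\<^sup>2 - 2 * A3\<^sup>2 + A2 * A4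
      = b1\<^sup>2 - b1 ^ 4 + 1 / 2 * (b1\<^sup>2 * b2) - 2 / 9 * b2\<^sup>2 + 1 / 6 * (b1 * b3)"
    by (simp add: A2_def A3_def A4_def field_simps power2_eq_square power3_eq_cube power4_eq_xxxx)
  also have "norm \<dots> \<le> norm (b1\<^sup>2) + norm (b1 ^ 4) + norm (1 / 2 * (b1\<^sup>2 * b2))
      + norm (2 / 9 * b2\<^sup>2) + norm (1 / 6 * (b1 * b3))"
    by (intro norm_triangle_mono norm_triangle_le_diff add_mono norm_triangle_ineq4 order_refl
        order_trans [OF norm_triangle_ineq4] order_trans [OF norm_triangle_ineq])
  also have "\<dots> = norm (b1\<^sup>2) + norm (b1 ^ 4) + 1 / 2 * norm (b1\<^sup>2 * b2)
      + 2 / 9 * norm (b2\<^sup>2) + 1 / 6 * norm (b1 * b3)"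
    by (simp only: norm_mult norm_divide norm_numeral norm_one)
  also have "\<dots> \<le> 2"
    using n2 n4 b112 b22 b13 s by linarith
  finally show "norm (A2\<^sup>2 - 2 * A3\<^sup>2 + A2 * A4) \<le> 2" .
qed

lemma inverse_coeff_bounds:
  assumes f: "f \<in> convex_class"
  defines "A \<equiv> taylor_coeff (disc_inverse f)"
  shows "norm (A 2) \<le> 1" and "norm (A 3) \<le> 1" and "norm (A 4) \<le> 1"
    and "norm ((A 2)\<^sup>2 - 2 * (A 3)\<^sup>2 + A 2 * A 4) \<le> 2"
proof -
  define B where "B = fps_expansion (schwarz_quotient f) 0"
  note holo = schwarz_quotient_holomorphic [OF f] and bounded = schwarz_quotient_bounded [OF f]
  have B: "schwarz_quotient f has_fps_expansion B"
    unfolding B_def by (rule holomorphic_on_disc_has_fps_expansion [OF holo])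
  have "norm (fps_nth B 0) \<le> 1"
    by (rule coeff_le_1_if_bounded_by_1 [OF holo bounded B])
  moreover have "norm (fps_nth B 1) \<le> 1 - (norm (fps_nth B 0))\<^sup>2"
    by (rule first_nonconstant_coeff_bound [OF holo bounded B]) auto
  moreover have "norm (fps_nth B 2) \<le> 1 - (norm (fps_nth B 0))\<^sup>2"
    by (rule second_coeff_bound [OF holo bounded B])
  ultimately show "norm (A 2) \<le> 1" "norm (A 3) \<le> 1" "norm (A 4) \<le> 1"
    "norm ((A 2)\<^sup>2 - 2 * (A 3)\<^sup>2 + A 2 * A 4) \<le> 2"
    unfolding A_def inverse_taylor_coeffs [OF f B]
    by (rule inverse_coeff_polynomial_bounds)+
qed

section \<open>The extremal function\<close>

text \<open>The half-plane map \<open>z / (1 - z)\<close> is extremal for the inverse coefficients, with \<open>A2, A3, A4 = -1, 1, -1\<close>,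
  but all three determinants vanish for it. Rotating by \<open>\<i>\<close> turns the coefficients into \<open>-\<i>, -1, \<i>\<close>, whose squares
  have alternating signs.\<close>

definition rotated_half_plane_map :: "complex \<Rightarrow> complex" where
  "rotated_half_plane_map z = z / (1 - \<i> * z)"

lemma one_minus_i_times_nonzero:
  assumes "norm z < 1"
  shows "1 - \<i> * z \<noteq> 0"
proof
  assume "1 - \<i> * z = 0"
  then have "norm (\<i> * z) = 1" by simp
  then show False using assms by (simp add: norm_mult)
qed

lemma deriv_rotated_half_plane_map:
  assumes z: "norm z < 1"
  shows "deriv rotated_half_plane_map z = 1 / (1 - \<i> * z) ^ 2"
    and "deriv (deriv rotated_half_plane_map) z = 2 * \<i> / (1 - \<i> * z) ^ 3"
proof -
  have d: "(rotated_half_plane_map has_field_derivative 1 / (1 - \<i> * z) ^ 2) (at z)" if "norm z < 1" for z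
    unfolding rotated_half_plane_map_def
    using one_minus_i_times_nonzero [OF that]
    by (auto intro!: derivative_eq_intros simp: power2_eq_square)
  show "deriv rotated_half_plane_map z = 1 / (1 - \<i> * z) ^ 2"
    using d [OF z] by (rule DERIV_imp_deriv)
  have "((\<lambda>z. 1 / (1 - \<i> * z) ^ 2) has_field_derivative 2 * \<i> / (1 - \<i> * z) ^ 3) (at z)"
    using one_minus_i_times_nonzero [OF z]
    by (auto intro!: derivative_eq_intros simp: divide_simps eval_nat_numeral)
  then have "(deriv rotated_half_plane_map has_field_derivative 2 * \<i> / (1 - \<i> * z) ^ 3) (at z)"
    by (rule has_field_derivative_transform_within_open [where S = "ball 0 1"])
      (use z DERIV_imp_deriv [OF d] in auto)
  then show "deriv (deriv rotated_half_plane_map) z = 2 * \<i> / (1 - \<i> * z) ^ 3"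
    by (rule DERIV_imp_deriv)
qed

lemma rotated_half_plane_map_convex: "rotated_half_plane_map \<in> convex_class"
proof -
  have "rotated_half_plane_map holomorphic_on ball 0 1"
    unfolding rotated_half_plane_map_def
    using one_minus_i_times_nonzero by (intro holomorphic_intros) auto
  then have "rotated_half_plane_map \<in> normalized_class"
    using deriv_rotated_half_plane_map(1) [of 0]
    by (simp add: normalized_class_def analytic_on_open) (simp add: rotated_half_plane_map_def)
  moreover have "Re (1 + z * deriv (deriv rotated_half_plane_map) z / deriv rotated_half_plane_map z) > 0"
    if z: "norm z < 1" for z
  proof -
    \<comment> \<open>The disc \<open>\<bar>1 - u\<bar> < 1\<close> is carried by \<open>inverse\<close> onto the half-plane \<open>Re > 1/2\<close>.\<close>
    define u where "u = 1 - \<i> * z"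
    have u: "u \<noteq> 0"
      using one_minus_i_times_nonzero [OF z] by (simp add: u_def)
    have iz: "\<i> * z = 1 - u" by (simp add: u_def)
    have "norm (1 - u) < 1"
      using z unfolding iz [symmetric] by (simp add: norm_mult)
    have "z * deriv (deriv rotated_half_plane_map) z / deriv rotated_half_plane_map z = 2 * (\<i> * z) / u"
      unfolding deriv_rotated_half_plane_map [OF z] u_def [symmetric]
      using u by (simp add: divide_simps eval_nat_numeral)
    then have "1 + z * deriv (deriv rotated_half_plane_map) z / deriv rotated_half_plane_map z
        = 2 * inverse u - 1"
      unfolding iz using u by (simp add: field_simps)
    moreover have "2 * Re u > (norm u)\<^sup>2"
    proof -
      have "(norm (1 - u))\<^sup>2 < 1"
        using \<open>norm (1 - u) < 1\<close> by (simp add: power_less_one_iff)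
      then show ?thesis
        unfolding cmod_power2 by (simp add: power2_eq_square algebra_simps)
    qed
    then have "Re (2 * inverse u - 1) > 0"
      using u by (simp add: cmod_power2 [symmetric] less_divide_eq)
    ultimately show ?thesis by (simp only:)
  qed
  ultimately show ?thesis
    using one_minus_i_times_nonzero
    by (auto simp: convex_class_def deriv_rotated_half_plane_map(1))
qed

text \<open>The Schwarz quotient of this map is the constant \<open>\<i>\<close>.\<close>

lemma rotated_half_plane_map_inverse_coeffs:
  "taylor_coeff (disc_inverse rotated_half_plane_map) 2 = - \<i>"
  "taylor_coeff (disc_inverse rotated_half_plane_map) 3 = - 1"
  "taylor_coeff (disc_inverse rotated_half_plane_map) 4 = \<i>"
proof -
  have "schwarz_quotient rotated_half_plane_map z = \<i>" if z: "z \<in> ball 0 1" for z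
  proof -
    have nz: "1 - \<i> * z \<noteq> 0" and z: "norm z < 1"
      using one_minus_i_times_nonzero that by auto
    define u where "u = 1 - \<i> * z"
    have "2 * (1 / u ^ 2) + z * (2 * \<i> / u ^ 3) = 2 * (u + \<i> * z) / u ^ 3"
      using nz by (simp add: u_def [symmetric] field_simps eval_nat_numeral)
    then show ?thesis
      unfolding schwarz_quotient_def deriv_rotated_half_plane_map [OF z] u_def [symmetric]
      using nz by (simp add: u_def)
  qed
  then have "eventually (\<lambda>z. schwarz_quotient rotated_half_plane_map z = \<i>) (nhds 0)"
    using eventually_nhds_in_open [of "ball (0::complex) 1" 0] by (auto elim!: eventually_mono)
  then have B: "schwarz_quotient rotated_half_plane_map has_fps_expansion fps_const \<i>"
    by (subst has_fps_expansion_cong [where g = "\<lambda>_. \<i>" and G = "fps_const \<i>"]) auto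
  show "taylor_coeff (disc_inverse rotated_half_plane_map) 2 = - \<i>"
    "taylor_coeff (disc_inverse rotated_half_plane_map) 3 = - 1"
    "taylor_coeff (disc_inverse rotated_half_plane_map) 4 = \<i>"
    unfolding inverse_taylor_coeffs [OF rotated_half_plane_map_convex B]
    by (simp_all add: power3_eq_cube)
qed

section \<open>Symmetric Toeplitz determinants\<close>

lemma det_2x2:
  fixes M :: "'a :: comm_ring_1 mat"
  assumes "M \<in> carrier_mat 2 2"
  shows "Determinant.det M = M $$ (0, 0) * M $$ (1, 1) - M $$ (0, 1) * M $$ (1, 0)"
proof -
  have "Determinant.det M = (\<Sum>j<2. M $$ (0, j) * cofactor M 0 j)"
    by (rule laplace_expansion_row [OF assms]) simp
  also have "\<dots> = M $$ (0, 0) * M $$ (1, 1) - M $$ (0, 1) * M $$ (1, 0)"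
    using assms by (simp add: numeral_2_eq_2 cofactor_def det_single mat_delete_def)
  finally show ?thesis .
qed

lemma sym_toeplitz_det_2:
  "sym_toeplitz_det 2 n g = (taylor_coeff g n)\<^sup>2 - (taylor_coeff g (n + 1))\<^sup>2"
  unfolding sym_toeplitz_det_def by (subst det_2x2) (simp_all add: power2_eq_square)

lemma sym_toeplitz_det_3:
  fixes g n
  defines "a \<equiv> taylor_coeff g n" and "b \<equiv> taylor_coeff g (n + 1)" and "c \<equiv> taylor_coeff g (n + 2)"
  shows "sym_toeplitz_det 3 n g = (a - c) * (a\<^sup>2 - 2 * b\<^sup>2 + a * c)"
proof -
  define M where "M = Matrix.mat 3 3 (\<lambda>(i, j). taylor_coeff g (n + nat \<bar>int i - int j\<bar>))"
  have "M \<in> carrier_mat 3 3" by (simp add: M_def)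
  then have "Determinant.det M = (\<Sum>j<3. M $$ (0, j) * cofactor M 0 j)"
    by (rule laplace_expansion_row) simp
  also have "\<dots> = a * (a * a - b * b) - b * (b * a - b * c) + c * (b * b - a * c)"
    by (simp add: numeral_3_eq_3 cofactor_def M_def mat_delete_def det_2x2 [unfolded numeral_2_eq_2]
        a_def b_def c_def) (simp add: algebra_simps)
  finally show ?thesis
    by (simp add: sym_toeplitz_det_def M_def power2_eq_square algebra_simps)
qed

theorem theorem5:
  shows "(\<forall>f\<in>convex_class. norm (sym_toeplitz_det 2 2 (disc_inverse f)) \<le> 2) \<and>
         (\<forall>f\<in>convex_class. norm (sym_toeplitz_det 2 3 (disc_inverse f)) \<le> 2) \<and>
         (\<forall>f\<in>convex_class. norm (sym_toeplitz_det 3 2 (disc_inverse f)) \<le> 4) \<and>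
         (\<exists>f\<in>convex_class. norm (sym_toeplitz_det 2 2 (disc_inverse f)) = 2) \<and>
         (\<exists>f\<in>convex_class. norm (sym_toeplitz_det 2 3 (disc_inverse f)) = 2) \<and>
         (\<exists>f\<in>convex_class. norm (sym_toeplitz_det 3 2 (disc_inverse f)) = 4)"
proof (intro conjI ballI)
  have sq: "norm (x\<^sup>2 - y\<^sup>2) \<le> 2" if "norm x \<le> 1" "norm y \<le> 1" for x y :: complex
  proof -
    have "norm (x\<^sup>2 - y\<^sup>2) \<le> (norm x)\<^sup>2 + (norm y)\<^sup>2"
      using norm_triangle_ineq4 [of "x\<^sup>2" "y\<^sup>2"] by (simp add: norm_power)
    also have "\<dots> \<le> 1 + 1"
      using that by (intro add_mono) (auto simp: power_le_one)
    finally show ?thesis by simp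
  qed
  fix f assume f: "f \<in> convex_class"
  note A = inverse_coeff_bounds [OF f]
  show "norm (sym_toeplitz_det 2 2 (disc_inverse f)) \<le> 2"
    using sq [OF A(1,2)] by (simp add: sym_toeplitz_det_2)
  show "norm (sym_toeplitz_det 2 3 (disc_inverse f)) \<le> 2"
    using sq [OF A(2,3)] by (simp add: sym_toeplitz_det_2)
  define A where "A = taylor_coeff (disc_inverse f)"
  have "norm (A 2 - A 4) \<le> 2"
    using norm_triangle_ineq4 [of "A 2" "A 4"] A(1,3) by (simp add: A_def)
  then have "norm (A 2 - A 4) * norm ((A 2)\<^sup>2 - 2 * (A 3)\<^sup>2 + A 2 * A 4) \<le> 2 * 2"
    using A(4) by (intro mult_mono) (auto simp: A_def)
  then show "norm (sym_toeplitz_det 3 2 (disc_inverse f)) \<le> 4"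
    by (simp add: sym_toeplitz_det_3 norm_mult A_def)
next
  show "\<exists>f\<in>convex_class. norm (sym_toeplitz_det 2 2 (disc_inverse f)) = 2"
    by (rule bexI [OF _ rotated_half_plane_map_convex])
      (simp add: sym_toeplitz_det_2 rotated_half_plane_map_inverse_coeffs)
  show "\<exists>f\<in>convex_class. norm (sym_toeplitz_det 2 3 (disc_inverse f)) = 2"
    by (rule bexI [OF _ rotated_half_plane_map_convex])
      (simp add: sym_toeplitz_det_2 rotated_half_plane_map_inverse_coeffs)
  show "\<exists>f\<in>convex_class. norm (sym_toeplitz_det 3 2 (disc_inverse f)) = 4"
    by (rule bexI [OF _ rotated_half_plane_map_convex])
      (simp add: sym_toeplitz_det_3 rotated_half_plane_map_inverse_coeffs norm_mult)
qed

end
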